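(* Let $A,B\subseteq \mathbb{R}^2$ be two closed convex sets with more than one common point such that $A$ and $B$ are polyhedral at every point in $\operatorname{bdry} A \cap \operatorname{bdry} B$ (if any). Then, for any starting point $x_0\in \mathbb{R}^2$, the Douglas--Rachford method applied to $(A, B)$ converges in finitely many iterations to a point in $\operatorname{Fix} T_{DR}$; that is, there is an $n\in\mathbb{N}$ (possibly depending on $x_0$) with $T_{DR}^n(x_0)\in \operatorname{Fix} T_{DR}$.
   Context: For a nonempty closed convex set $C\subseteq\mathbb{R}^2$, $P_C(x)$ is the unique nearest point of $C$ to $x$ in the Euclidean norm, and $R_C = 2P_C-\mathrm{Id}$. The Douglas--Rachford operator of the ordered pair $(A,B)$ is $T_{DR} = \frac12(\mathrm{Id}+R_B\circ R_A)$. $\operatorname{Fix} T=\{x : T(x)=x\}$, and $T^n$ is the $n$-fold composition. The Douglas--Rachford method from $x_0$ generates $x_n=T_{DR}^n(x_0)$. $\operatorname{bdry} S$ is the topological boundary of $S$ in $\mathbb{R}^2$. A set is polyhedral at $x$ if there exists a neighbourhood of $x$ in which the set coincides with some polyhedral set (a finite intersection of closed half-spaces). *)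

theory Defs
  imports "HOL-Analysis.Analysis"
begin

definition reflector :: "'a::euclidean_space set \<Rightarrow> 'a \<Rightarrow> 'a" where
  "reflector C x = 2 *\<^sub>R closest_point C x - x"

text \<open>The ordered pair \<open>(A, B)\<close> reflects in \<open>A\<close> first.\<close>
definition douglas_rachford :: "'a::euclidean_space set \<Rightarrow> 'a set \<Rightarrow> 'a \<Rightarrow> 'a" where
  "douglas_rachford A B x = (1 / 2) *\<^sub>R (x + (reflector B \<circ> reflector A) x)"

definition Fix :: "('a \<Rightarrow> 'a) \<Rightarrow> 'a set" where
  "Fix T = {x. T x = x}"

definition polyhedral_at :: "'a::euclidean_space set \<Rightarrow> 'a \<Rightarrow> bool" where
  "polyhedral_at S x \<longleftrightarrow> (\<exists>U P. open U \<and> x \<in> U \<and> polyhedron P \<and> S \<inter> U = P \<inter> U)"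

end

theory Submission
  imports Defs
begin

text \<open>
  Write \<open>N\<close> for the composition of the two reflections, so that the Douglas--Rachford operator is
  the average \<open>T = (id + N) / 2\<close> with \<open>N\<close> nonexpansive. The points of \<open>A \<inter> B\<close> are fixed by \<open>N\<close>,
  hence the iterates converge to some fixed point \<open>l\<close> (\<open>averaged_iterates_converge\<close>), and the
  nearest point \<open>c\<close> of \<open>A\<close> to \<open>l\<close> lies in \<open>A \<inter> B\<close>.

  If \<open>c\<close> is interior to one of the sets, then \<open>l = c\<close>, late iterates no longer feel that set, and a
  single projection onto the other set lands in \<open>A \<inter> B\<close>. Otherwise \<open>c\<close> lies on both boundaries, so
  both sets are polyhedral at \<open>c\<close>. Near \<open>l\<close> the reflection in \<open>A\<close> then acts as the reflection in a
  cone, and a reflection in a cone preserves the distance to the apex; the same holds for \<open>B\<close>.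
  Therefore \<open>N\<close> preserves the distance to \<open>l\<close> near \<open>l\<close> (\<open>reflector_isometric_near\<close>).

  In the plane this settles the matter (\<open>isometric_orbit_stabilizes\<close>). Take \<open>l\<close> as the origin. As
  \<open>N\<close> preserves norms, it turns each vector \<open>y\<close> by some angle \<open>2 \<phi>\<close>, and averaging turns \<open>y\<close> by \<open>\<phi>\<close>
  and shrinks it by the factor \<open>cos \<phi>\<close>. As \<open>N\<close> is nonexpansive, it does not increase angles between
  vectors, so consecutive turns have the same sense and never grow. An orbit that tends to \<open>0\<close>
  without stopping would have to turn through an infinite total angle. But \<open>A \<inter> B\<close> provides a
  second fixed point \<open>u\<close> of \<open>N\<close>, and the inner product with \<open>u\<close> increases to \<open>0\<close> along the orbit,
  which confines the orbit to a half-plane.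
\<close>

section \<open>Reflections in convex sets\<close>

text \<open>
  The error term pairs the difference of the projections with the difference of the residuals.
  It is nonnegative for convex sets, and the reflection is isometric exactly when it vanishes.
\<close>

lemma dist_reflector_sq:
  fixes C :: "'a::euclidean_space set" and x z :: 'a
  defines "a \<equiv> closest_point C x" and "c \<equiv> closest_point C z"
  shows "(dist (reflector C x) (reflector C z))\<^sup>2
    = (dist x z)\<^sup>2 - 4 * ((a - c) \<bullet> ((x - a) - (z - c)))"
  unfolding reflector_def a_def[symmetric] c_def[symmetric] dist_norm power2_norm_eq_inner
  by (simp add: algebra_simps inner_commute)

lemma reflector_nonexpansive:
  fixes C :: "'a::euclidean_space set"
  assumes "closed C" "convex C" "C \<noteq> {}"
  shows "dist (reflector C x) (reflector C z) \<le> dist x z"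
proof -
  let ?a = "closest_point C x" and ?c = "closest_point C z"
  have "(x - ?a) \<bullet> (?c - ?a) \<le> 0" "(z - ?c) \<bullet> (?a - ?c) \<le> 0"
    using assms by (auto intro!: closest_point_dot closest_point_in_set)
  then have "(?a - ?c) \<bullet> ((x - ?a) - (z - ?c)) \<ge> 0"
    by (simp add: algebra_simps inner_commute)
  then have "(dist (reflector C x) (reflector C z))\<^sup>2 \<le> (dist x z)\<^sup>2"
    by (simp add: dist_reflector_sq)
  then show ?thesis
    by (simp add: power2_le_iff_abs_le)
qed

lemma reflector_eq_self: "x \<in> C \<Longrightarrow> reflector C x = x"
  by (simp add: reflector_def closest_point_self scaleR_2)

lemma continuous_reflector:
  fixes C :: "'a::euclidean_space set"
  assumes "closed C" "convex C" "C \<noteq> {}"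
  shows "continuous (at x) (reflector C)"
  unfolding reflector_def using continuous_at_closest_point[OF assms(2,1,3)]
  by (intro continuous_intros)

text \<open>A point outside a closed set has its nearest points on the boundary.\<close>

lemma closest_point_in_interior_imp_eq:
  fixes C :: "'a::euclidean_space set"
  assumes "closed C" "closest_point C x \<in> interior C"
  shows "closest_point C x = x"
proof -
  have "interior C \<noteq> {}"
    using assms by blast
  then have "x \<in> affine hull C" "C \<noteq> {}" "rel_interior C = interior C"
    using interior_subset by (auto simp: affine_hull_nonempty_interior rel_interior_nonempty_interior)
  then have "x \<in> interior C"
    using assms closest_point_in_rel_interior[of C x] by auto
  then show ?thesis
    using closest_point_self interior_subset by blast
qed

section \<open>Reflections near a polyhedral point\<close>

text \<open>
  Near \<open>c\<close>, the projection of \<open>z\<close>, the set is cut out by finitely many linear constraints. For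
  \<open>x\<close> near \<open>z\<close>, the projection \<open>a\<close> of \<open>x\<close> is near \<open>c\<close>, hence satisfies with equality only constraints
  that \<open>c\<close> also satisfies with equality; moving from \<open>a\<close> along the line through \<open>c\<close> and \<open>a\<close> is
  therefore possible in both directions, which makes \<open>x - a\<close> orthogonal to \<open>a - c\<close>. The residual
  \<open>z - c\<close> is orthogonal to \<open>a - c\<close> as well: the normal cone at \<open>a\<close> depends only on the set of active
  constraints, so it is one of finitely many closed cones, and those that contain residuals
  \<open>x - a\<close> arbitrarily close to \<open>z - c\<close> contain \<open>z - c\<close> itself. With both orthogonalities the error
  term in \<open>dist_reflector_sq\<close> vanishes.
\<close>

lemma reflector_isometric_near:
  fixes C :: "'a::euclidean_space set"
  assumes C: "closed C" "convex C" "C \<noteq> {}" and poly: "polyhedral_at C (closest_point C z)"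
  shows "\<forall>\<^sub>F x in nhds z. dist (reflector C x) (reflector C z) = dist x z"
proof -
  let ?cp = "closest_point C"
  define c where "c = ?cp z"
  obtain U P where U: "open U" "c \<in> U" and P: "polyhedron P" and CP: "C \<inter> U = P \<inter> U"
    using poly unfolding polyhedral_at_def c_def by blast
  obtain F where F: "finite F" "P = \<Inter>F"
      "\<forall>h\<in>F. \<exists>a b. a \<noteq> 0 \<and> h = {x. a \<bullet> x \<le> b}"
    using P unfolding polyhedron_def by blast
  then obtain m \<beta> where mb: "\<And>h. h \<in> F \<Longrightarrow> h = {x. m h \<bullet> x \<le> \<beta> h}"
    by metis
  then have memP: "x \<in> P \<longleftrightarrow> (\<forall>h\<in>F. m h \<bullet> x \<le> \<beta> h)" for x
    using F(2) by blast
  define active where "active x = {h\<in>F. m h \<bullet> x = \<beta> h}" for x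
  define feasible where "feasible I = {d. \<forall>h\<in>I. m h \<bullet> d \<le> 0}" for I
  have "c \<in> C"
    unfolding c_def using C closest_point_in_set by blast
  then have "c \<in> P"
    using CP U by blast
  have cont: "(?cp \<longlongrightarrow> c) (nhds z)"
    using continuous_at_closest_point[OF C(2,1,3), of z]
    unfolding c_def continuous_at tendsto_at_iff_tendsto_nhds .
  have nearU: "\<forall>\<^sub>F x in nhds z. ?cp x \<in> U"
    using topological_tendstoD[OF cont U] .
  \<comment> \<open>The residual of a point is normal to all directions that the constraints active at its
    projection allow, since a short move in such a direction stays in the set.\<close>
  have normal: "(x - ?cp x) \<bullet> d \<le> 0" if "?cp x \<in> U" "d \<in> feasible (active (?cp x))" for x d
  proof -
    let ?a = "?cp x"
    have "?a \<in> C"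
      using C closest_point_in_set by blast
    then have "?a \<in> P"
      using CP that by blast
    have lim: "((\<lambda>t. ?a + t *\<^sub>R d) \<longlongrightarrow> ?a) (at_right (0::real))"
      by (rule tendsto_eq_intros refl | simp)+
    have "\<forall>\<^sub>F t in at_right (0::real). m h \<bullet> (?a + t *\<^sub>R d) \<le> \<beta> h" if h: "h \<in> F" for h
    proof (cases "h \<in> active ?a")
      case True
      then have "m h \<bullet> d \<le> 0"
        using \<open>d \<in> feasible _\<close> by (simp add: feasible_def)
      then have "m h \<bullet> (?a + t *\<^sub>R d) \<le> \<beta> h" if "t > 0" for t
        using True that by (simp add: active_def inner_add_right mult_nonneg_nonpos)
      then show ?thesis
        by (auto simp: eventually_at_right_less eventually_at_filter)
    next
      case False
      then have "m h \<bullet> ?a < \<beta> h"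
        using h \<open>?a \<in> P\<close> memP by (force simp: active_def)
      moreover have "((\<lambda>t. m h \<bullet> (?a + t *\<^sub>R d)) \<longlongrightarrow> m h \<bullet> ?a) (at_right (0::real))"
        by (intro tendsto_intros lim)
      ultimately show ?thesis
        using order_tendstoD(2) by (auto elim!: eventually_mono dest!: order_tendstoD(2))
    qed
    then have "\<forall>\<^sub>F t in at_right (0::real). \<forall>h\<in>F. m h \<bullet> (?a + t *\<^sub>R d) \<le> \<beta> h"
      using F(1) by (simp add: eventually_ball_finite_distrib)
    moreover have "\<forall>\<^sub>F t in at_right (0::real). ?a + t *\<^sub>R d \<in> U"
      using topological_tendstoD[OF lim U(1) that(1)] .
    moreover have "\<forall>\<^sub>F t in at_right (0::real). t > 0"
      by (rule eventually_at_right_less)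
    ultimately have "\<forall>\<^sub>F t in at_right (0::real). t > 0 \<and> ?a + t *\<^sub>R d \<in> C"
      by eventually_elim (use CP memP in blast)
    then obtain t :: real where t: "t > 0" "?a + t *\<^sub>R d \<in> C"
      using eventually_happens'[OF trivial_limit_at_right_real] by blast
    then have "(x - ?a) \<bullet> (?a + t *\<^sub>R d - ?a) \<le> 0"
      using C closest_point_dot by blast
    then show ?thesis
      using t(1) by (simp add: mult_le_0_iff)
  qed
  have near_active: "\<forall>\<^sub>F x in nhds z. active (?cp x) \<subseteq> active c"
  proof -
    have "\<forall>\<^sub>F x in nhds z. h \<in> active (?cp x) \<longrightarrow> h \<in> active c" if "h \<in> F" for h
    proof (cases "h \<in> active c")
      case False
      then have "m h \<bullet> c < \<beta> h"
        using that \<open>c \<in> P\<close> memP by (force simp: active_def)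
      moreover have "((\<lambda>x. m h \<bullet> ?cp x) \<longlongrightarrow> m h \<bullet> c) (nhds z)"
        by (intro tendsto_intros cont)
      ultimately have "\<forall>\<^sub>F x in nhds z. m h \<bullet> ?cp x < \<beta> h"
        using order_tendstoD(2) by blast
      then show ?thesis
        by eventually_elim (simp add: active_def)
    qed simp
    then have "\<forall>\<^sub>F x in nhds z. \<forall>h\<in>F. h \<in> active (?cp x) \<longrightarrow> h \<in> active c"
      using F(1) by (simp add: eventually_ball_finite_distrib)
    then show ?thesis
      by eventually_elim (auto simp: active_def)
  qed
  \<comment> \<open>An index set \<open>I\<close> whose normal cone misses \<open>z - c\<close> is excluded by one separating direction,
    and the finitely many exclusions hold simultaneously near \<open>z\<close>.\<close>
  have near_normal: "\<forall>\<^sub>F x in nhds z. \<forall>d\<in>feasible (active (?cp x)). (z - c) \<bullet> d \<le> 0"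
  proof -
    have "\<forall>\<^sub>F x in nhds z. active (?cp x) = I \<longrightarrow> (\<forall>d\<in>feasible I. (z - c) \<bullet> d \<le> 0)" for I
    proof (cases "\<forall>d\<in>feasible I. (z - c) \<bullet> d \<le> 0")
      case False
      then obtain d where d: "d \<in> feasible I" "(z - c) \<bullet> d > 0"
        by force
      have "((\<lambda>x. (x - ?cp x) \<bullet> d) \<longlongrightarrow> (z - c) \<bullet> d) (nhds z)"
        by (intro tendsto_intros cont filterlim_ident)
      then have "\<forall>\<^sub>F x in nhds z. (x - ?cp x) \<bullet> d > 0"
        using d(2) order_tendstoD(1) by blast
      with nearU show ?thesis
        by eventually_elim (use normal d(1) in force)
    qed simp
    then have "\<forall>\<^sub>F x in nhds z. \<forall>I\<in>Pow F. active (?cp x) = I \<longrightarrow>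
        (\<forall>d\<in>feasible I. (z - c) \<bullet> d \<le> 0)"
      using F(1) by (intro eventually_ball_finite) auto
    then show ?thesis
      by eventually_elim (auto simp: active_def)
  qed
  show ?thesis
    using nearU near_active near_normal
  proof eventually_elim
    case (elim x)
    let ?a = "?cp x"
    have "?a \<in> C"
      using C closest_point_in_set by blast
    \<comment> \<open>The first direction is allowed because \<open>c\<close> satisfies all constraints, the second because
      those active at the projection of \<open>x\<close> are also active at \<open>c\<close>.\<close>
    have "c - ?a \<in> feasible (active ?a)"
      using \<open>c \<in> P\<close> memP by (auto simp: feasible_def active_def inner_diff_right)
    moreover have "?a - c \<in> feasible (active ?a)"
      using elim(2) by (auto simp: feasible_def active_def inner_diff_right)
    ultimately have "(x - ?a) \<bullet> (c - ?a) \<le> 0" "(x - ?a) \<bullet> (?a - c) \<le> 0"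
      "(z - c) \<bullet> (c - ?a) \<le> 0" "(z - c) \<bullet> (?a - c) \<le> 0"
      using normal[OF elim(1)] elim(3) by auto
    then have "(?a - c) \<bullet> ((x - ?a) - (z - c)) = 0"
      by (simp add: algebra_simps inner_commute)
    then have "(dist (reflector C x) (reflector C z))\<^sup>2 = (dist x z)\<^sup>2"
      by (simp add: dist_reflector_sq c_def)
    then show ?case
      by simp
  qed
qed

section \<open>Convergence of averaged iterates\<close>

text \<open>
  This is the theorem of Krasnoselskii and Mann. Each step decreases the squared distance to every
  fixed point by at least a quarter of the squared displacement of \<open>N\<close>. So the displacements tend to
  \<open>0\<close> and every cluster point is fixed; applying the monotonicity to a cluster point shows that the
  whole sequence converges to it.
\<close>

lemma averaged_iterates_converge:
  fixes N :: "'a::euclidean_space \<Rightarrow> 'a"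
  assumes N: "\<And>x y. dist (N x) (N y) \<le> dist x y" and p: "N p = p"
    and x: "\<And>n. x (Suc n) = (1/2) *\<^sub>R (x n + N (x n))"
  shows "\<exists>l. N l = l \<and> x \<longlonglongrightarrow> l"
proof -
  have fejer: "(dist (x (Suc n)) q)\<^sup>2 + (dist (N (x n)) (x n))\<^sup>2 / 4 \<le> (dist (x n) q)\<^sup>2"
    if "N q = q" for n q
  proof -
    let ?u = "x n - q" and ?v = "N (x n) - q"
    have "dist (N (x n)) q \<le> dist (x n) q"
      using N[of "x n" q] that by simp
    then have "?v \<bullet> ?v \<le> ?u \<bullet> ?u"
      by (simp add: dist_norm norm_le)
    moreover have "dist (x (Suc n)) q = norm ((1/2) *\<^sub>R (?u + ?v))"
    proof -
      have "x (Suc n) - q = (1/2) *\<^sub>R (?u + ?v)"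
        using scaleR_half_double[of q]
        by (simp only: x scaleR_right_distrib scaleR_right_diff_distrib) (metis add_diff_add)
      then show ?thesis
        by (simp only: dist_norm)
    qed
    moreover have "dist (N (x n)) (x n) = norm (?v - ?u)"
      by (simp add: dist_norm)
    moreover have "(norm ((1/2) *\<^sub>R (a + b)))\<^sup>2 + (norm (b - a))\<^sup>2 / 4 = (a \<bullet> a + b \<bullet> b) / 2"
      for a b :: 'a
      unfolding power2_norm_eq_inner by (simp add: inner_add inner_diff inner_commute field_simps)
    ultimately have "(dist (x (Suc n)) q)\<^sup>2 + (dist (N (x n)) (x n))\<^sup>2 / 4 = (?u \<bullet> ?u + ?v \<bullet> ?v) / 2"
      by (simp only:)
    also have "\<dots> \<le> (?u \<bullet> ?u + ?u \<bullet> ?u) / 2"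
      using \<open>?v \<bullet> ?v \<le> ?u \<bullet> ?u\<close> by (intro divide_right_mono add_left_mono) auto
    also have "\<dots> = (dist (x n) q)\<^sup>2"
      by (simp add: dist_norm power2_norm_eq_inner)
    finally show ?thesis .
  qed
  have mono: "decseq (\<lambda>n. dist (x n) q)" if "N q = q" for q
  proof (rule decseq_SucI)
    fix n
    have "(dist (x (Suc n)) q)\<^sup>2 \<le> (dist (x n) q)\<^sup>2"
      using fejer[OF that, of n] zero_le_power2[of "dist (N (x n)) (x n)"] by linarith
    then show "dist (x (Suc n)) q \<le> dist (x n) q"
      by (rule power2_le_imp_le) simp
  qed
  have "bounded (range x)"
    using decseqD[OF mono[OF p], of 0] by (auto simp: bounded_any_center[of _ p] dist_commute)
  then obtain l r where r: "strict_mono r" and l: "(x \<circ> r) \<longlonglongrightarrow> l"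
    using bounded_imp_convergent_subsequence by blast
  define \<delta> where "\<delta> n = (dist (x n) p)\<^sup>2" for n
  have "decseq \<delta>"
    using decseqD[OF mono[OF p]] by (auto simp: \<delta>_def decseq_def intro: power_mono)
  then have "convergent \<delta>"
    by (intro Bseq_monoseq_convergent decseq_bounded[of _ 0] decseq_imp_monoseq) (auto simp: \<delta>_def)
  then obtain L where L: "\<delta> \<longlonglongrightarrow> L"
    by (auto simp: convergent_def)
  have "(\<lambda>n. 4 * (\<delta> n - \<delta> (Suc n))) \<longlonglongrightarrow> 4 * (L - L)"
    by (intro tendsto_intros L LIMSEQ_Suc)
  then have upper: "(\<lambda>n. 4 * (\<delta> n - \<delta> (Suc n))) \<longlonglongrightarrow> 0"
    by simp
  have "(dist (N (x n)) (x n))\<^sup>2 \<le> 4 * (\<delta> n - \<delta> (Suc n))" for n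
    using fejer[OF p, of n] by (simp add: \<delta>_def)
  then have "(\<lambda>n. (dist (N (x n)) (x n))\<^sup>2) \<longlonglongrightarrow> 0"
    by (intro tendsto_sandwich[OF _ _ tendsto_const upper]) auto
  then have gap: "(\<lambda>n. (dist (N (x (r n))) (x (r n)))\<^sup>2) \<longlonglongrightarrow> 0"
    using LIMSEQ_subseq_LIMSEQ[OF _ r] by (auto simp: o_def)
  have "continuous (at l) N"
    unfolding continuous_at_eps_delta using N le_less_trans by blast
  then have "(\<lambda>n. N (x (r n))) \<longlonglongrightarrow> N l"
    using isCont_tendsto_compose[of l N "\<lambda>n. x (r n)"] l by (simp only: o_def)
  then have "(\<lambda>n. (dist (N (x (r n))) (x (r n)))\<^sup>2) \<longlonglongrightarrow> (dist (N l) l)\<^sup>2"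
    using l by (intro tendsto_power tendsto_dist) (simp_all only: o_def)
  then have "(dist (N l) l)\<^sup>2 = 0"
    using gap by (rule LIMSEQ_unique)
  then have fixl: "N l = l"
    by simp
  have "x \<longlonglongrightarrow> l"
  proof (rule LIMSEQ_I)
    fix e :: real assume "e > 0"
    then obtain k where "dist (x (r k)) l < e"
      using LIMSEQ_D[OF l] by (metis comp_apply dist_norm order_refl)
    then have "dist (x n) l < e" if "n \<ge> r k" for n
      using decseqD[OF mono[OF fixl] that] by linarith
    then show "\<exists>no. \<forall>n\<ge>no. norm (x n - l) < e"
      by (auto simp: dist_norm)
  qed
  with fixl show ?thesis
    by blast
qed

section \<open>Isometric orbits in the plane\<close>

definition cross :: "real ^ 2 \<Rightarrow> real ^ 2 \<Rightarrow> real" where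
  "cross v w = v $ 1 * w $ 2 - v $ 2 * w $ 1"

text \<open>
  The vector \<open>v\<close> and its quarter turn form an orthogonal basis; the inner products with the quarter
  turn of \<open>v\<close> are the values of \<open>cross v\<close>.
\<close>

lemma planar_inner_decomposition:
  fixes v w d :: "real ^ 2"
  shows "(v \<bullet> v) * (w \<bullet> d) = (w \<bullet> v) * (v \<bullet> d) + cross v w * cross v d"
  by (simp add: cross_def inner_vec_def sum_2) algebra

text \<open>
  Here \<open>z n\<close> plays the role of \<open>N (y n)\<close>, and \<open>u\<close> that of a second fixed point of \<open>N\<close>; only the values
  along the orbit matter. If the orbit never stops, all its turns are nondegenerate and have the
  same sense \<open>\<sigma>\<close>. The key observation (\<open>ahead\<close>) is that a step from \<open>y n\<close> to \<open>y (Suc n)\<close> is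
  perpendicular to \<open>y (Suc n)\<close> and points forward in the sense of rotation, so it increases the inner
  product with every vector \<open>d\<close> that lies ahead of the orbit by at most a half turn. As the orbit
  tends to \<open>0\<close>, these inner products are nonpositive. The vector \<open>d\<close> that bounds the half-plane of
  \<open>y n \<bullet> u \<le> 0\<close> on the forward side is always ahead; the resulting inequality says that \<open>- u\<close> is
  ahead as well, and this forces the orbit onto the line perpendicular to \<open>u\<close>, where no turn is
  possible.
\<close>

lemma isometric_orbit_stabilizes:
  fixes y :: "nat \<Rightarrow> real ^ 2"
  defines "z \<equiv> \<lambda>n. 2 *\<^sub>R y (Suc n) - y n"
  assumes lim: "y \<longlonglongrightarrow> 0"
    and iso: "\<And>n. norm (z n) = norm (y n)"
    and nonexp: "\<And>m n. dist (z m) (z n) \<le> dist (y m) (y n)"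
    and u: "u \<noteq> 0" "\<And>n. dist (z n) u \<le> dist (y n) u"
  shows "\<exists>n. y (Suc n) = y n"
proof (rule ccontr)
  assume "\<nexists>n. y (Suc n) = y n"
  then have moves: "y (Suc n) \<noteq> y n" for n
    by blast
  have zz: "z n \<bullet> z n = y n \<bullet> y n" for n
    using iso by (simp add: norm_eq)
  have orth: "y n \<bullet> y (Suc n) = y (Suc n) \<bullet> y (Suc n)" for n
    using zz[of n] by (simp add: z_def algebra_simps inner_commute)
  have nonzero: "y n \<noteq> 0" for n
    using iso[of n] moves[of n] by (auto simp: z_def)
  \<comment> \<open>As norms are preserved, nonexpansiveness becomes a comparison of angles.\<close>
  have angle: "y m \<bullet> y n \<le> z m \<bullet> z n" for m n
  proof -
    have "(z m - z n) \<bullet> (z m - z n) \<le> (y m - y n) \<bullet> (y m - y n)"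
      using nonexp[of m n] by (simp add: dist_norm norm_le)
    then show ?thesis
      using zz[of m] zz[of n] by (simp add: inner_diff inner_commute)
  qed
  have cross_nz: "cross (y n) (y (Suc n)) \<noteq> 0" for n
  proof
    assume 0: "cross (y n) (y (Suc n)) = 0"
    let ?d = "y n - y (Suc n)"
    have "cross (y (Suc n)) ?d = 0"
      using 0 by (simp add: cross_def algebra_simps)
    moreover have "?d \<bullet> y (Suc n) = 0"
      using orth[of n] by (simp add: inner_diff)
    ultimately have "(y (Suc n) \<bullet> y (Suc n)) * (?d \<bullet> ?d) = 0"
      by (subst planar_inner_decomposition) simp
    then show False
      using nonzero moves[of n] by simp
  qed
  define \<sigma> where "\<sigma> = sgn (cross (y 0) (y 1))"
  have \<sigma>: "\<sigma> * \<sigma> = 1"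
    using cross_nz[of 0] by (auto simp: \<sigma>_def sgn_if)
  have \<sigma>_cancel: "(\<sigma> * a) * (\<sigma> * b) = a * b" for a b
    using \<sigma> by algebra
  \<comment> \<open>Let the step from \<open>X\<close> to \<open>Y\<close> turn by \<open>\<phi>\<close>. Then \<open>z n\<close> is at angle \<open>\<phi>\<close> ahead of \<open>Y\<close>, and \<open>z (Suc n)\<close> is
    within the angle \<open>\<phi>\<close> of \<open>z n\<close>, so it does not fall behind \<open>Y\<close>.\<close>
  have turn: "\<sigma> * cross (y n) (y (Suc n)) > 0" for n
  proof (induction n)
    case 0
    then show ?case
      using cross_nz[of 0] by (auto simp: \<sigma>_def sgn_if)
  next
    case (Suc n)
    let ?X = "y n" and ?Y = "y (Suc n)" and ?Z = "y (Suc (Suc n))" and ?w = "z (Suc n)"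
    have pos: "?Y \<bullet> ?Y > 0"
      using nonzero by simp
    have "?w \<bullet> ?Y \<le> norm ?w * norm ?Y"
      by (rule norm_cauchy_schwarz)
    also have "\<dots> = ?Y \<bullet> ?Y"
      by (simp only: iso) (simp add: norm_eq_sqrt_inner)
    finally have "(?w \<bullet> ?Y) * (?Y \<bullet> ?Y) \<le> (?Y \<bullet> ?Y) * (?Y \<bullet> ?Y)"
      using pos by simp
    moreover have "(?Y \<bullet> ?Y) * (?Y \<bullet> ?Y) \<le> (?Y \<bullet> ?Y) * (?w \<bullet> z n)"
      using angle[of "Suc n" n] orth[of n] pos by (simp add: inner_commute)
    moreover have "?Y \<bullet> z n = ?Y \<bullet> ?Y" "cross ?Y (z n) = cross ?X ?Y"
      using orth[of n] by (simp_all add: z_def cross_def inner_diff inner_commute algebra_simps)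
    moreover have "cross ?Y ?w = 2 * cross ?Y ?Z"
      by (simp add: z_def cross_def algebra_simps)
    ultimately have "cross ?Y ?Z * cross ?X ?Y \<ge> 0"
      using planar_inner_decomposition[of ?Y ?w "z n"] by simp
    then have "(\<sigma> * cross ?Y ?Z) * (\<sigma> * cross ?X ?Y) \<ge> 0"
      by (simp only: \<sigma>_cancel)
    then have "\<sigma> * cross ?Y ?Z \<ge> 0"
      using Suc.IH by (simp add: zero_le_mult_iff)
    moreover have "\<sigma> * cross ?Y ?Z \<noteq> 0"
      using cross_nz[of "Suc n"] \<sigma> by auto
    ultimately show ?case
      by (rule order_le_neq_trans[OF _ not_sym])
  qed
  have to_zero: "y n \<bullet> d \<le> 0" if "\<And>n. y n \<bullet> d \<le> y (Suc n) \<bullet> d" for n d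
  proof -
    have "(\<lambda>n. y n \<bullet> d) \<longlonglongrightarrow> 0 \<bullet> d"
      by (intro tendsto_intros lim)
    then show ?thesis
      using that incseq_le[of "\<lambda>n. y n \<bullet> d"] by (simp add: incseq_SucI)
  qed
  have ahead: "y n \<bullet> d \<le> 0" if d: "\<And>n. \<sigma> * cross (y n) d \<ge> 0" for n d
  proof (rule to_zero)
    fix n
    let ?X = "y n" and ?Y = "y (Suc n)"
    have "(?Y \<bullet> ?Y) * ((?Y - ?X) \<bullet> d) = cross ?X ?Y * cross ?Y d"
      using planar_inner_decomposition[of ?Y "?Y - ?X" d] orth[of n]
      by (simp add: inner_diff cross_def algebra_simps)
    also have "\<dots> = (\<sigma> * cross ?X ?Y) * (\<sigma> * cross ?Y d)"
      by (simp only: \<sigma>_cancel)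
    also have "\<dots> \<ge> 0"
      using turn[of n] d[of "Suc n"] by simp
    finally show "?X \<bullet> d \<le> ?Y \<bullet> d"
      using nonzero[of "Suc n"] inner_gt_zero_iff[of ?Y]
      by (simp add: zero_le_mult_iff inner_diff_left del: inner_gt_zero_iff)
  qed
  \<comment> \<open>The orbit stays in the half-plane opposite to the second fixed point.\<close>
  have yu: "y n \<bullet> u \<le> 0" for n
  proof (rule to_zero)
    fix n
    have "(z n - u) \<bullet> (z n - u) \<le> (y n - u) \<bullet> (y n - u)"
      using u(2)[of n] by (simp add: dist_norm norm_le)
    then have "y n \<bullet> u \<le> z n \<bullet> u"
      using zz[of n] by (simp add: inner_diff inner_commute)
    then show "y n \<bullet> u \<le> y (Suc n) \<bullet> u"
      by (simp add: z_def inner_diff)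
  qed
  define d :: "real ^ 2" where "d = vector [\<sigma> * u $ 2, - \<sigma> * u $ 1]"
  have d: "cross (y n) d = - \<sigma> * (y n \<bullet> u)" "y n \<bullet> d = \<sigma> * cross (y n) u" for n
    by (simp_all add: d_def cross_def inner_vec_def sum_2 algebra_simps)
  have "\<sigma> * cross (y n) d \<ge> 0" for n
    using yu[of n] \<sigma> by (simp add: d flip: mult.assoc)
  then have "\<sigma> * cross (y n) u \<le> 0" for n
    using ahead[of d n] d(2) by simp
  then have "\<sigma> * cross (y n) (- u) \<ge> 0" for n
    by (simp add: cross_def algebra_simps)
  then have "y n \<bullet> (- u) \<le> 0" for n
    by (rule ahead)
  then have perp: "y n \<bullet> u = 0" for n
    using yu[of n] by (simp add: order_antisym)
  have "(u \<bullet> u) * cross (y 0) (y 1) = 0"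
    using perp[of 0] perp[of 1] unfolding cross_def inner_vec_def sum_2 inner_real_def by algebra
  then show False
    using u(1) cross_nz[of 0] by simp
qed

section \<open>Finite convergence\<close>

text \<open>
  Every point of \<open>A \<inter> B\<close> is fixed, so the two distinct common points leave one that differs from the
  limit; it serves as the vector \<open>u\<close> of \<open>isometric_orbit_stabilizes\<close>.
\<close>

theorem corollary2p5:
  fixes A B :: "(real ^ 2) set" and x0 :: "real ^ 2"
  assumes "closed A" and "convex A"
    and "closed B" and "convex B"
    and "\<exists>p\<in>A \<inter> B. \<exists>q\<in>A \<inter> B. p \<noteq> q"
    and "\<forall>x\<in>frontier A \<inter> frontier B. polyhedral_at A x \<and> polyhedral_at B x"
  shows "\<exists>n. (douglas_rachford A B ^^ n) x0 \<in> Fix (douglas_rachford A B)"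
proof -
  let ?T = "douglas_rachford A B"
  define N where "N = reflector B \<circ> reflector A"
  define x where "x n = (?T ^^ n) x0" for n
  obtain p q where pq: "p \<in> A" "p \<in> B" "q \<in> A" "q \<in> B" "p \<noteq> q"
    using assms(5) by blast
  then have A: "closed A" "convex A" "A \<noteq> {}" and B: "closed B" "convex B" "B \<noteq> {}"
    using assms by auto
  have T: "?T v = (1/2) *\<^sub>R (v + N v)" for v
    by (simp add: douglas_rachford_def N_def)
  have T_alt: "?T v = v - closest_point A v + closest_point B (reflector A v)" for v
  proof -
    have "v + N v = 2 *\<^sub>R (v - closest_point A v + closest_point B (reflector A v))"
      by (simp add: N_def reflector_def scaleR_2 algebra_simps)
    then show ?thesis
      by (simp add: T)
  qed
  have step: "x (Suc n) = ?T (x n)" for n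
    by (simp add: x_def)
  have common_fixed: "N v = v" "v \<in> Fix ?T" if "v \<in> A" "v \<in> B" for v
  proof -
    show "N v = v"
      using that by (simp add: N_def reflector_eq_self)
    then have "?T v = v"
      by (metis T scaleR_half_double)
    then show "v \<in> Fix ?T"
      by (simp add: Fix_def)
  qed
  have nonexp: "dist (N v) (N w) \<le> dist v w" for v w
    unfolding N_def o_def
    using reflector_nonexpansive[OF B] reflector_nonexpansive[OF A] order_trans by blast
  obtain l where l: "N l = l" and lim: "x \<longlonglongrightarrow> l"
    using averaged_iterates_converge[of N p x] nonexp common_fixed(1) pq step T by metis
  define c where "c = closest_point A l"
  have "?T l = l"
    by (metis T l scaleR_half_double)
  then have cB: "closest_point B (reflector A l) = c"
    by (simp add: T_alt c_def)
  have c: "c \<in> A" "c \<in> B"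
    using closest_point_in_set A B cB c_def by metis+
  have "\<exists>n. x n \<in> Fix ?T"
  proof (cases "c \<in> interior A \<or> c \<in> interior B")
    case True
    then show ?thesis
    proof
      \<comment> \<open>Late iterates are fixed by the reflection in \<open>A\<close> and stay in \<open>A\<close> when projected onto \<open>B\<close>.\<close>
      assume int: "c \<in> interior A"
      have "l = c"
        using closest_point_in_interior_imp_eq A(1) int c_def by metis
      have "\<forall>\<^sub>F n in sequentially. x n \<in> interior A"
        using topological_tendstoD[OF lim] int \<open>l = c\<close> by auto
      moreover have "\<forall>\<^sub>F n in sequentially. x (Suc n) \<in> interior A"
        using topological_tendstoD[OF LIMSEQ_Suc[OF lim]] int \<open>l = c\<close> by auto
      ultimately have "\<forall>\<^sub>F n in sequentially. x n \<in> A \<and> x (Suc n) \<in> A"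
        by eventually_elim (use interior_subset in blast)
      then obtain n where "x n \<in> A" "x (Suc n) \<in> A"
        by (auto simp: eventually_sequentially)
      moreover have "x (Suc n) = closest_point B (x n)"
        using \<open>x n \<in> A\<close> by (simp add: step T_alt reflector_eq_self closest_point_self)
      ultimately show ?thesis
        using common_fixed(2) closest_point_in_set B by metis
    next
      \<comment> \<open>The reflection in \<open>A\<close> moves late iterates into \<open>B\<close>, so that \<open>T\<close> is the projection onto \<open>A\<close>.\<close>
      assume int: "c \<in> interior B"
      then have "reflector A l = c"
        using closest_point_in_interior_imp_eq B(1) cB by metis
      then have "l = c"
        by (simp add: reflector_def c_def[symmetric] scaleR_2 algebra_simps)
      have "(\<lambda>n. reflector A (x n)) \<longlonglongrightarrow> c"
        using isCont_tendsto_compose[OF continuous_reflector[OF A] lim] \<open>reflector A l = c\<close>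
        by simp
      then have "\<forall>\<^sub>F n in sequentially. reflector A (x n) \<in> interior B"
        using topological_tendstoD int by blast
      moreover have "\<forall>\<^sub>F n in sequentially. x (Suc n) \<in> interior B"
        using topological_tendstoD[OF LIMSEQ_Suc[OF lim]] int \<open>l = c\<close> by auto
      ultimately have "\<forall>\<^sub>F n in sequentially. reflector A (x n) \<in> B \<and> x (Suc n) \<in> B"
        by eventually_elim (use interior_subset in blast)
      then obtain n where "reflector A (x n) \<in> B" "x (Suc n) \<in> B"
        by (auto simp: eventually_sequentially)
      moreover have "x (Suc n) = closest_point A (x n)"
        using \<open>reflector A (x n) \<in> B\<close>
        by (simp add: step T_alt closest_point_self) (simp add: reflector_def scaleR_2)
      ultimately show ?thesis
        using common_fixed(2) closest_point_in_set A by metis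
    qed
  next
    case False
    then have "c \<in> frontier A \<inter> frontier B"
      using c A(1) B(1) by (simp add: frontier_def closure_closed)
    then have poly: "polyhedral_at A c" "polyhedral_at B c"
      using assms(6) by auto
    have "\<forall>\<^sub>F v in nhds l. dist (reflector A v) (reflector A l) = dist v l"
      using reflector_isometric_near[OF A] poly(1) by (simp add: c_def)
    moreover have "\<forall>\<^sub>F v in nhds l. dist (reflector B (reflector A v)) (reflector B (reflector A l))
        = dist (reflector A v) (reflector A l)"
    proof -
      have "\<forall>\<^sub>F w in nhds (reflector A l). dist (reflector B w) (reflector B (reflector A l))
          = dist w (reflector A l)"
        using reflector_isometric_near[OF B] poly(2) cB by simp
      moreover have "filterlim (reflector A) (nhds (reflector A l)) (nhds l)"
        using continuous_reflector[OF A, of l]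
        by (simp add: continuous_at tendsto_at_iff_tendsto_nhds)
      ultimately show ?thesis
        by (rule eventually_compose_filterlim)
    qed
    ultimately have "\<forall>\<^sub>F v in nhds l. dist (N v) l = dist v l"
      by eventually_elim (use l in \<open>simp add: N_def\<close>)
    then have "\<forall>\<^sub>F n in sequentially. dist (N (x n)) l = dist (x n) l"
      using lim by (rule eventually_compose_filterlim)
    then obtain k where k: "\<And>n. n \<ge> k \<Longrightarrow> dist (N (x n)) l = dist (x n) l"
      by (auto simp: eventually_sequentially)
    obtain r where r: "N r = r" "r \<noteq> l"
      using common_fixed(1) pq by metis
    \<comment> \<open>From index \<open>k\<close> on the iterates stay where \<open>N\<close> preserves the distance to \<open>l\<close>.\<close>
    define y where "y n = x (n + k) - l" for n
    have z: "2 *\<^sub>R y (Suc n) - y n = N (x (n + k)) - l" for n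
      by (simp add: y_def step T algebra_simps scaleR_2)
    have "\<exists>n. y (Suc n) = y n"
    proof (rule isometric_orbit_stabilizes[of y "r - l"], unfold z)
      show "y \<longlonglongrightarrow> 0"
        unfolding y_def using LIMSEQ_ignore_initial_segment[OF lim, of k] by (simp add: LIM_zero)
      show "norm (N (x (n + k)) - l) = norm (y n)" for n
        using k[of "n + k"] by (simp add: y_def dist_norm)
      show "dist (N (x (m + k)) - l) (N (x (n + k)) - l) \<le> dist (y m) (y n)" for m n
        using nonexp by (simp add: y_def dist_norm)
      show "dist (N (x (n + k)) - l) (r - l) \<le> dist (y n) (r - l)" for n
        using nonexp[of "x (n + k)" r] r(1) by (simp add: y_def dist_norm)
      show "r - l \<noteq> 0"
        using r by simp
    qed
    then obtain n where "x (Suc (n + k)) = x (n + k)"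
      by (auto simp: y_def)
    then show ?thesis
      by (auto simp: Fix_def step)
  qed
  then show ?thesis
    by (simp add: x_def)
qed

end
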